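(* Let $(X,\|\cdot,\dots,\cdot\|^{*})$ be an $n_1$-normed space and $(Z,\|\cdot,\dots,\cdot\|^{**})$ an $n_2$-normed space, with fixed linearly independent sets of $n_1$ vectors in $X$ and of $n_2$ vectors in $Z$, and let $l_1,l_2\in\{1,\dots,n_1\}$ and $m_1,m_2\in\{1,\dots,n_2\}$. If a mapping $T:X\to Z$ is continuous with respect to the norms of class-$(l_1,m_1)$ collections, then $T$ is continuous with respect to the norms of class-$(l_2,m_2)$ collections.
   Context: Let $n$ be a positive integer and $X$ a real vector space with $\dim X\ge n$. An $n$-norm on $X$ is a map $\|\cdot,\dots,\cdot\|:X^n\to\mathbb{R}$ such that (i) $\|x_1,\dots,x_n\|\ge 0$, with equality if and only if $x_1,\dots,x_n$ are linearly dependent; (ii) it is invariant under permutations of its arguments; (iii) $\|\alpha x_1,x_2,\dots,x_n\|=|\alpha|\,\|x_1,\dots,x_n\|$ for $\alpha\in\mathbb{R}$; (iv) $\|x_1+x_1',x_2,\dots,x_n\|\le\|x_1,x_2,\dots,x_n\|+\|x_1',x_2,\dots,x_n\|$. The pair $(X,\|\cdot,\dots,\cdot\|)$ is called an $n$-normed space. Fix a linearly independent set $Y=\{y_1,\dots,y_n\}\subset X$. For $m\in\{1,\dots,n\}$ and an $m$-element subset $\{i_1,\dots,i_m\}\subset\{1,\dots,n\}$, let $Y^0_{i_1,\dots,i_m}=\mathrm{span}\{y_i: i\notin\{i_1,\dots,i_m\}\}$, let $X^*_{i_1,\dots,i_m}=X/Y^0_{i_1,\dots,i_m}$, let $\overline{u}$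 denote the coset of $u\in X$, and define the norm $$\|\overline{u}\|^*_{i_1,\dots,i_m}=\sum_{j=1}^m\|u,y_1,\dots,y_{i_j-1},y_{i_j+1},\dots,y_n\|$$ on $X^*_{i_1,\dots,i_m}$. The set of these $\binom{n}{m}$ quotient spaces is the class-$m$ collection, and their norms are "the norms of class-$m$ collection". For an $n_1$-normed space $X$ and an $n_2$-normed space $Z$ (each with a fixed linearly independent set of $n_1$, respectively $n_2$, vectors), denote the norms of class-$l$ collection of $X$ by $\|\cdot\|^*_{i_1,\dots,i_l}$ and those of class-$m$ collection of $Z$ by $\|\cdot\|^{**}_{j_1,\dots,j_m}$. A mapping $f:X\to Z$ is continuous with respect to the norms of class-$(l,m)$ collections at $a\in X$ if for every $\epsilon>0$ there is $\delta>0$ such that for every $x\in X$ with $\|\overline{x-a}\|^*_{i_1,\dots,i_l}<\delta$ for every $l$-element subset $\{i_1,\dots,i_l\}\subset\{1,\dots,n_1\}$, one has $\|\overline{f(x)-f(a)}\|^{**}_{j_1,\dots,j_m}<\epsilon$ for every $m$-element subset $\{j_1,\dots,j_m\}\subset\{1,\dots,n_2\}$. It is continuous with respect to the norms of class-$(l,m)$ collections (on $X$) if this holds at each $a\in X$. *)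

theory Defs
  imports Complex_Main "HOL-Library.Multiset" "HOL-Library.Set_Algebras"
begin

text \<open>
  Tuples of vectors are lists. Linear independence is that of the family, so a tuple with a
  repeated entry is dependent; dependence of the set of entries alone would miss this.
\<close>

definition indep_list :: "'a::real_vector list \<Rightarrow> bool" where
  "indep_list xs \<longleftrightarrow> distinct xs \<and> independent (set xs)"

text \<open>
  The function \<open>N\<close> is only constrained on lists of length \<open>n\<close>. The condition \<open>dim X \<ge> n\<close> is
  expressed by an independent \<open>n\<close>-tuple, because \<open>dim\<close> is \<open>0\<close> on infinite-dimensional spaces.
\<close>

locale n_normed_space =
  fixes n :: nat and N :: "'a::real_vector list \<Rightarrow> real"
  assumes n_pos: "n \<ge> 1"
    and dim_ge: "\<exists>xs :: 'a list. length xs = n \<and> indep_list xs"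
    and nonneg: "length xs = n \<Longrightarrow> N xs \<ge> 0"
    and eq_0_iff: "length xs = n \<Longrightarrow> N xs = 0 \<longleftrightarrow> \<not> indep_list xs"
    and perm: "length xs = n \<Longrightarrow> mset xs = mset ys \<Longrightarrow> N xs = N ys"
    and scale: "length (x # xs) = n \<Longrightarrow> N ((c *\<^sub>R x) # xs) = \<bar>c\<bar> * N (x # xs)"
    and triangle: "length (x # xs) = n \<Longrightarrow> N ((x + x') # xs) \<le> N (x # xs) + N (x' # xs)"

text \<open>
  The vectors \<open>y\<^sub>1, \<dots>, y\<^sub>n\<close> are the entries of a list \<open>ys\<close>, indexed from \<open>0\<close>; an index set
  \<open>{i\<^sub>1, \<dots>, i\<^sub>m}\<close> is a set \<open>I \<subseteq> {..<length ys}\<close> of cardinality \<open>m\<close>.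
\<close>

definition omit :: "nat \<Rightarrow> 'a list \<Rightarrow> 'a list" where
  "omit j ys = take j ys @ drop (Suc j) ys"

definition Y0 :: "'a::real_vector list \<Rightarrow> nat set \<Rightarrow> 'a set" where
  "Y0 ys I = span {ys ! i | i. i < length ys \<and> i \<notin> I}"

definition coset :: "'a::real_vector list \<Rightarrow> nat set \<Rightarrow> 'a \<Rightarrow> 'a set" where
  "coset ys I u = u +o Y0 ys I"

text \<open>
  The sum takes the same value at all representatives of a coset (lemma \<open>quotient_norm_coset\<close>
  below), so the image of the coset is a singleton.
\<close>

definition quotient_norm ::
    "('a::real_vector list \<Rightarrow> real) \<Rightarrow> 'a list \<Rightarrow> nat set \<Rightarrow> 'a set \<Rightarrow> real" where
  "quotient_norm N ys I C = the_elem ((\<lambda>u. \<Sum>j\<in>I. N (u # omit j ys)) ` C)"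

definition index_sets :: "'a list \<Rightarrow> nat \<Rightarrow> nat set set" where
  "index_sets ys m = {I. I \<subseteq> {..<length ys} \<and> card I = m}"

definition class_continuous_at ::
    "('a::real_vector list \<Rightarrow> real) \<Rightarrow> 'a list \<Rightarrow> nat \<Rightarrow>
     ('b::real_vector list \<Rightarrow> real) \<Rightarrow> 'b list \<Rightarrow> nat \<Rightarrow> ('a \<Rightarrow> 'b) \<Rightarrow> 'a \<Rightarrow> bool" where
  "class_continuous_at N ys l M zs m f a \<longleftrightarrow>
     (\<forall>\<epsilon>>0. \<exists>\<delta>>0. \<forall>x.
        (\<forall>I\<in>index_sets ys l. quotient_norm N ys I (coset ys I (x - a)) < \<delta>) \<longrightarrow>
        (\<forall>J\<in>index_sets zs m. quotient_norm M zs J (coset zs J (f x - f a)) < \<epsilon>))"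

definition class_continuous ::
    "('a::real_vector list \<Rightarrow> real) \<Rightarrow> 'a list \<Rightarrow> nat \<Rightarrow>
     ('b::real_vector list \<Rightarrow> real) \<Rightarrow> 'b list \<Rightarrow> nat \<Rightarrow> ('a \<Rightarrow> 'b) \<Rightarrow> bool" where
  "class_continuous N ys l M zs m f \<longleftrightarrow> (\<forall>a. class_continuous_at N ys l M zs m f a)"

lemma length_omit: "j < length ys \<Longrightarrow> Suc (length (omit j ys)) = length ys"
  by (simp add: omit_def)

lemma nth_in_omit:
  assumes "i < length ys" "i \<noteq> j"
  shows "ys ! i \<in> set (omit j ys)"
proof (cases "i < j")
  case True
  then have "ys ! i \<in> set (take j ys)"
    using assms by (auto simp: in_set_conv_nth intro!: exI[of _ i])
  then show ?thesis by (simp add: omit_def)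
next
  case False
  then have "ys ! i \<in> set (drop (Suc j) ys)"
    using assms by (auto simp: in_set_conv_nth intro!: exI[of _ "i - Suc j"])
  then show ?thesis by (simp add: omit_def)
qed

context n_normed_space
begin

lemma N_span_0:
  assumes "length (w # xs) = n" "w \<in> span (set xs)"
  shows "N (w # xs) = 0"
proof -
  have "\<not> indep_list (w # xs)"
  proof
    assume "indep_list (w # xs)"
    then have "w \<notin> set xs" "independent (insert w (set xs))"
      by (auto simp: indep_list_def)
    then show False using assms(2) by (simp add: independent_insert)
  qed
  then show ?thesis using assms(1) eq_0_iff by blast
qed

lemma N_add_span:
  assumes "length (u # xs) = n" "w \<in> span (set xs)"
  shows "N ((u + w) # xs) = N (u # xs)"
proof -
  have "N ((u + w) # xs) \<le> N (u # xs) + N (w # xs)"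
    using assms triangle by blast
  moreover have "N (((u + w) + (- w)) # xs) \<le> N ((u + w) # xs) + N ((- w) # xs)"
    by (rule triangle) (use assms in simp)
  moreover have "N (w # xs) = 0" "N ((- w) # xs) = 0"
    using assms N_span_0 N_span_0[of "- w" xs] span_neg[of w] by simp_all
  ultimately show ?thesis by simp
qed

lemma quotient_norm_coset:
  assumes "length ys = n" "I \<subseteq> {..<length ys}"
  shows "quotient_norm N ys I (coset ys I u) = (\<Sum>j\<in>I. N (u # omit j ys))"
proof -
  have "(\<Sum>j\<in>I. N ((u + w) # omit j ys)) = (\<Sum>j\<in>I. N (u # omit j ys))"
    if w: "w \<in> Y0 ys I" for w
  proof (rule sum.cong)
    fix j assume j: "j \<in> I"
    have "{ys ! i | i. i < length ys \<and> i \<notin> I} \<subseteq> set (omit j ys)"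
      using j by (clarify, intro nth_in_omit) auto
    then have "w \<in> span (set (omit j ys))"
      using w unfolding Y0_def by (meson span_mono subsetD)
    then show "N ((u + w) # omit j ys) = N (u # omit j ys)"
      using assms j length_omit[of j ys] by (intro N_add_span) auto
  qed simp
  moreover have "0 \<in> Y0 ys I"
    by (simp add: Y0_def span_zero)
  moreover have "coset ys I u = (\<lambda>w. u + w) ` Y0 ys I"
    unfolding coset_def elt_set_plus_def by blast
  ultimately have "(\<lambda>u. \<Sum>j\<in>I. N (u # omit j ys)) ` coset ys I u
      = (\<lambda>w. \<Sum>j\<in>I. N (u # omit j ys)) ` Y0 ys I" and "Y0 ys I \<noteq> {}"
    by (auto simp only: image_image intro!: image_cong)
  then have "(\<lambda>u. \<Sum>j\<in>I. N (u # omit j ys)) ` coset ys I u = {\<Sum>j\<in>I. N (u # omit j ys)}"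
    by (simp add: image_constant_conv)
  then show ?thesis by (simp add: quotient_norm_def)
qed

end

end

theory Submission imports Defs begin

text \<open>
  Every index lies in some index set of the given size, so smallness of all norms of one class
  is smallness of all the numbers \<open>N (u # omit j ys)\<close>, whatever the class. The norms of any two
  classes therefore bound each other up to the factor \<open>n\<close>.
\<close>

lemma (in n_normed_space) class_norms_less:
  assumes ys: "length ys = n" and l: "l \<in> {1..n}"
    and small: "\<forall>I\<in>index_sets ys l. quotient_norm N ys I (coset ys I u) < d / n"
    and J: "J \<in> index_sets ys m"
  shows "quotient_norm N ys J (coset ys J u) < d"
proof -
  have nonneg_omit: "N (u # omit j ys) \<ge> 0" if "j < n" for j
    using that ys length_omit[of j ys] by (intro nonneg) simp
  have less: "N (u # omit j ys) < d / n" if j: "j < n" for j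
  proof -
    \<comment> \<open>Since \<open>1 \<le> l \<le> n\<close>, the singleton \<open>{j}\<close>
      extends to an index set of size \<open>l\<close>. Its norm is a sum of nonnegative terms, so
      it dominates the term at \<open>j\<close>.\<close>
    obtain I where I: "{j} \<subseteq> I" "I \<subseteq> {..<n}" "card I = l"
      using exists_subset_between[of "{j}" l "{..<n}"] l j by auto
    have "N (u # omit j ys) \<le> (\<Sum>i\<in>I. N (u # omit i ys))"
      using I nonneg_omit by (intro member_le_sum) (auto intro: finite_subset)
    also have "\<dots> < d / n"
      using small I ys quotient_norm_coset[of ys I u] by (auto simp: index_sets_def)
    finally show ?thesis .
  qed
  have J': "J \<subseteq> {..<n}" "card J = m" "finite J"
    using J ys by (auto simp: index_sets_def intro: finite_subset)
  have "quotient_norm N ys J (coset ys J u) = (\<Sum>j\<in>J. N (u # omit j ys))"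
    using J' ys by (intro quotient_norm_coset) auto
  \<comment> \<open>Passing from \<open>J\<close> to all \<open>n\<close> indices makes the bound
    the same for every \<open>m\<close>, and the final strict inequality survives even for empty
    \<open>J\<close>.\<close>
  also have "\<dots> \<le> (\<Sum>j<n. N (u # omit j ys))"
    using J' nonneg_omit by (intro sum_mono2) auto
  also have "\<dots> < (\<Sum>j<n. d / n)"
    using n_pos less by (intro sum_strict_mono) (auto simp: lessThan_empty_iff)
  also have "\<dots> = d"
    using n_pos by simp
  finally show ?thesis .
qed

theorem corollary3p3:
  fixes N :: "'a::real_vector list \<Rightarrow> real" and M :: "'b::real_vector list \<Rightarrow> real"
    and ys :: "'a list" and zs :: "'b list"
    and n1 n2 l1 l2 m1 m2 :: nat
    and T :: "'a \<Rightarrow> 'b"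
  assumes "n_normed_space n1 N" and "n_normed_space n2 M"
    and "length ys = n1" and "indep_list ys"
    and "length zs = n2" and "indep_list zs"
    and "l1 \<in> {1..n1}" and "l2 \<in> {1..n1}"
    and "m1 \<in> {1..n2}" and "m2 \<in> {1..n2}"
    and "class_continuous N ys l1 M zs m1 T"
  shows "class_continuous N ys l2 M zs m2 T"
  unfolding class_continuous_def class_continuous_at_def
proof (intro allI impI)
  fix a and e :: real
  assume "e > 0"
  have pos: "real n1 > 0" "real n2 > 0"
    using assms(7,9) by auto
  with \<open>e > 0\<close> have "e / n2 > 0"
    by simp
  \<comment> \<open>The tolerance \<open>e / n2\<close> absorbs the factor \<open>n2\<close> lost in
    \<open>Z\<close> when class \<open>m1\<close> is traded for class \<open>m2\<close>.\<close>
  then obtain d where d: "d > 0"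
    and T: "\<And>x. \<forall>I\<in>index_sets ys l1. quotient_norm N ys I (coset ys I (x - a)) < d \<Longrightarrow>
      \<forall>J\<in>index_sets zs m1. quotient_norm M zs J (coset zs J (T x - T a)) < e / n2"
    using assms(11) unfolding class_continuous_def class_continuous_at_def by meson
  show "\<exists>d>0. \<forall>x.
      (\<forall>I\<in>index_sets ys l2. quotient_norm N ys I (coset ys I (x - a)) < d) \<longrightarrow>
      (\<forall>J\<in>index_sets zs m2. quotient_norm M zs J (coset zs J (T x - T a)) < e)"
  \<comment> \<open>In the domain the comparison runs the other way, from the new class
    \<open>l2\<close> back to \<open>l1\<close>, where continuity is known; this costs the factor
    \<open>n1\<close>.\<close>
  proof (intro exI[of _ "d / n1"] conjI allI impI ballI)
    show "d / n1 > 0"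
      using d pos by simp
  next
    fix x J
    assume "\<forall>I\<in>index_sets ys l2. quotient_norm N ys I (coset ys I (x - a)) < d / n1"
      and J: "J \<in> index_sets zs m2"
    then have "\<forall>I\<in>index_sets ys l1. quotient_norm N ys I (coset ys I (x - a)) < d"
      using n_normed_space.class_norms_less[OF assms(1,3,8)] by blast
    from T[OF this] show "quotient_norm M zs J (coset zs J (T x - T a)) < e"
      using n_normed_space.class_norms_less[OF assms(2,5,9)] J by blast
  qed
qed

end
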